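(* Let $A\in\mathbb{Q}_s^{m\times n}$, $C\in\mathbb{Q}_s^{m\times k}$, $R\in\mathbb{Q}_s^{k\times n}$, and define $U_\star=C^\dagger AR^\dagger$. Then $U_\star$ minimizes $\|A-CUR\|_F$ over $U\in\mathbb{Q}_s^{k\times k}$. More precisely, if $P_C=CC^\dagger$ and $P_R=R^\dagger R$, then $$CU_\star R=P_CAP_R,$$ and, for every $U\in\mathbb{Q}_s^{k\times k}$, $$\|A-CUR\|_F^2=\|A-P_CAP_R\|_F^2+\|P_CAP_R-CUR\|_F^2 .$$ Consequently, $$\min_{U\in\mathbb{Q}_s^{k\times k}}\|A-CUR\|_F=\|A-P_CAP_R\|_F .$$ The minimizing middle matrix need not be unique. It is unique if $C^\sigma$ has full column rank and $R^\sigma$ has full row rank.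
   Context: $\mathbb{Q}_s$ is the real algebra of split quaternions $q=q_1+q_2\mathbf{i}+q_3\mathbf{j}+q_4\mathbf{k}$ ($q_\ell\in\mathbb{R}$) with $\mathbf{i}^2=-1$, $\mathbf{j}^2=\mathbf{k}^2=1$, $\mathbf{i}\mathbf{j}=\mathbf{k}=-\mathbf{j}\mathbf{i}$, $\mathbf{j}\mathbf{k}=-\mathbf{i}=-\mathbf{k}\mathbf{j}$, $\mathbf{k}\mathbf{i}=\mathbf{j}=-\mathbf{i}\mathbf{k}$. A matrix $A\in\mathbb{Q}_s^{m\times n}$ is written $A=A_1+A_2\mathbf{i}+A_3\mathbf{j}+A_4\mathbf{k}$ with $A_\ell\in\mathbb{R}^{m\times n}$. Its real representation is $$A^\sigma=\begin{bmatrix} A_1+A_3 & -A_2+A_4 \\ A_2+A_4 & A_1-A_3 \end{bmatrix}\in\mathbb{R}^{2m\times 2n};$$ the map $\sigma: A\mapsto A^\sigma$ is a bijection $\mathbb{Q}_s^{m\times n}\to\mathbb{R}^{2m\times 2n}$ with inverse $\sigma^{-1}$ (for all sizes). For a real matrix $M$, $M^\dagger$ is the usual real Moore--Penrose inverse; for $A\in\mathbb{Q}_s^{m\times n}$, $A^\dagger:=\sigma^{-1}((A^\sigma)^\dagger)\in\mathbb{Q}_s^{n\times m}$. The norm is $\|A\|_F^2:=\sum_{\ell=1}^4\|A_\ell\|_F^2$. *)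

theory Defs
  imports "HOL-Analysis.Analysis"
begin

section \<open>The algebra of split quaternions\<close>

codatatype squat = Squat (sq1: real) (sq2: real) (sq3: real) (sq4: real)

lemma squat_eq_iff:
  "x = y \<longleftrightarrow> sq1 x = sq1 y \<and> sq2 x = sq2 y \<and> sq3 x = sq3 y \<and> sq4 x = sq4 y"
  by (auto intro: squat.expand)

instantiation squat :: real_algebra_1
begin

primcorec zero_squat where
  "sq1 0 = 0" | "sq2 0 = 0" | "sq3 0 = 0" | "sq4 0 = 0"

primcorec one_squat where
  "sq1 1 = 1" | "sq2 1 = 0" | "sq3 1 = 0" | "sq4 1 = 0"

primcorec plus_squat where
  "sq1 (x + y) = sq1 x + sq1 y"
| "sq2 (x + y) = sq2 x + sq2 y"
| "sq3 (x + y) = sq3 x + sq3 y"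
| "sq4 (x + y) = sq4 x + sq4 y"

primcorec uminus_squat where
  "sq1 (- x) = - sq1 x"
| "sq2 (- x) = - sq2 x"
| "sq3 (- x) = - sq3 x"
| "sq4 (- x) = - sq4 x"

primcorec minus_squat where
  "sq1 (x - y) = sq1 x - sq1 y"
| "sq2 (x - y) = sq2 x - sq2 y"
| "sq3 (x - y) = sq3 x - sq3 y"
| "sq4 (x - y) = sq4 x - sq4 y"

text \<open>The bilinear extension of the multiplication table of the units, which is
  recovered in the lemma \<open>squat_units_mult\<close> below.\<close>

primcorec times_squat where
  "sq1 (x * y) = sq1 x * sq1 y - sq2 x * sq2 y + sq3 x * sq3 y + sq4 x * sq4 y"
| "sq2 (x * y) = sq1 x * sq2 y + sq2 x * sq1 y - sq3 x * sq4 y + sq4 x * sq3 y"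
| "sq3 (x * y) = sq1 x * sq3 y + sq3 x * sq1 y - sq2 x * sq4 y + sq4 x * sq2 y"
| "sq4 (x * y) = sq1 x * sq4 y + sq4 x * sq1 y + sq2 x * sq3 y - sq3 x * sq2 y"

primcorec scaleR_squat where
  "sq1 (scaleR r x) = r * sq1 x"
| "sq2 (scaleR r x) = r * sq2 x"
| "sq3 (scaleR r x) = r * sq3 x"
| "sq4 (scaleR r x) = r * sq4 x"

instance
  by standard (auto simp: squat_eq_iff algebra_simps)

end

definition squat_i :: squat where "squat_i = Squat 0 1 0 0"
definition squat_j :: squat where "squat_j = Squat 0 0 1 0"
definition squat_k :: squat where "squat_k = Squat 0 0 0 1"

lemma squat_units_mult:
  "squat_i * squat_i = -1" "squat_j * squat_j = 1" "squat_k * squat_k = 1"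
  "squat_i * squat_j = squat_k" "squat_j * squat_i = - squat_k"
  "squat_j * squat_k = - squat_i" "squat_k * squat_j = squat_i"
  "squat_k * squat_i = squat_j" "squat_i * squat_k = - squat_j"
  by (simp_all add: squat_eq_iff squat_i_def squat_j_def squat_k_def)

lemma squat_decomp:
  "q = of_real (sq1 q) + sq2 q *\<^sub>R squat_i + sq3 q *\<^sub>R squat_j + sq4 q *\<^sub>R squat_k"
  by (simp add: squat_eq_iff squat_i_def squat_j_def squat_k_def of_real_def)


section \<open>The real representation of split quaternion matrices\<close>

text \<open>As usual in HOL-Analysis, an \<open>m \<times> n\<close> matrix over \<open>'a\<close> has type \<open>'a^'n^'m\<close>. The
  \<open>2m \<times> 2n\<close> matrices are indexed by the disjoint sums \<open>'m + 'm\<close> and \<open>'n + 'n\<close>, with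
  \<open>Inl\<close> addressing the first and \<open>Inr\<close> the second block.\<close>

definition part1 :: "squat^'n^'m \<Rightarrow> real^'n^'m" where "part1 A = (\<chi> i j. sq1 (A $ i $ j))"
definition part2 :: "squat^'n^'m \<Rightarrow> real^'n^'m" where "part2 A = (\<chi> i j. sq2 (A $ i $ j))"
definition part3 :: "squat^'n^'m \<Rightarrow> real^'n^'m" where "part3 A = (\<chi> i j. sq3 (A $ i $ j))"
definition part4 :: "squat^'n^'m \<Rightarrow> real^'n^'m" where "part4 A = (\<chi> i j. sq4 (A $ i $ j))"

definition block_matrix ::
  "'a^'n^'m \<Rightarrow> 'a^'n^'m \<Rightarrow> 'a^'n^'m \<Rightarrow> 'a^'n^'m \<Rightarrow> 'a^('n + 'n)^('m + 'm)" where
  "block_matrix P Q R S = (\<chi> i j. case i of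
      Inl i' \<Rightarrow> (case j of Inl j' \<Rightarrow> P $ i' $ j' | Inr j' \<Rightarrow> Q $ i' $ j')
    | Inr i' \<Rightarrow> (case j of Inl j' \<Rightarrow> R $ i' $ j' | Inr j' \<Rightarrow> S $ i' $ j'))"

definition real_rep :: "squat^'n^'m \<Rightarrow> real^('n + 'n)^('m + 'm)" where
  "real_rep A = block_matrix
     (part1 A + part3 A)      (part4 A - part2 A)
     (part2 A + part4 A)      (part1 A - part3 A)"

lemma bij_real_rep: "bij (real_rep :: squat^'n^'m \<Rightarrow> real^('n + 'n)^('m + 'm))"
proof (rule bijI)
  show "inj (real_rep :: squat^'n^'m \<Rightarrow> _)"
  proof (rule injI)
    fix A B :: "squat^'n^'m"
    assume eq: "real_rep A = real_rep B"
    have "A $ i $ j = B $ i $ j" for i j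
    proof -
      have "real_rep A $ x $ y = real_rep B $ x $ y" for x y
        using eq by simp
      from this[of "Inl i" "Inl j"] this[of "Inl i" "Inr j"]
           this[of "Inr i" "Inl j"] this[of "Inr i" "Inr j"]
      show ?thesis
        by (simp add: real_rep_def block_matrix_def part1_def part2_def part3_def part4_def
            squat_eq_iff)
    qed
    then show "A = B" by (simp add: vec_eq_iff)
  qed
  show "surj (real_rep :: squat^'n^'m \<Rightarrow> _)"
  proof (rule surjI)
    fix M :: "real^('n + 'n)^('m + 'm)"
    show "real_rep (\<chi> i j. Squat
        ((M $ Inl i $ Inl j + M $ Inr i $ Inr j) / 2)
        ((M $ Inr i $ Inl j - M $ Inl i $ Inr j) / 2)
        ((M $ Inl i $ Inl j - M $ Inr i $ Inr j) / 2)
        ((M $ Inr i $ Inl j + M $ Inl i $ Inr j) / 2)) = M"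
      by (auto simp: vec_eq_iff real_rep_def block_matrix_def part1_def part2_def part3_def
          part4_def field_simps split: sum.split)
  qed
qed


section \<open>Moore--Penrose inverses\<close>

definition is_mp_inverse :: "real^'n^'m \<Rightarrow> real^'m^'n \<Rightarrow> bool" where
  "is_mp_inverse M X \<longleftrightarrow>
     M ** X ** M = M \<and> X ** M ** X = X \<and>
     transpose (M ** X) = M ** X \<and> transpose (X ** M) = X ** M"

lemma is_mp_inverse_unique:
  assumes "is_mp_inverse M X" "is_mp_inverse M Y"
  shows "X = Y"
proof -
  from assms have X: "M ** X ** M = M" "X ** M ** X = X"
      "transpose (M ** X) = M ** X" "transpose (X ** M) = X ** M"
    and Y: "M ** Y ** M = M" "Y ** M ** Y = Y"
      "transpose (M ** Y) = M ** Y" "transpose (Y ** M) = Y ** M"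
    by (auto simp: is_mp_inverse_def)
  have "M ** X = transpose ((M ** Y) ** (M ** X))"
    using X(3) Y(1) by (metis matrix_mul_assoc)
  also have "\<dots> = (M ** X) ** (M ** Y)"
    using X(3) Y(3) by (simp add: matrix_transpose_mul)
  also have "\<dots> = M ** Y"
    using X(1) by (metis matrix_mul_assoc)
  finally have MX: "M ** X = M ** Y" .
  have "X ** M = transpose ((X ** M) ** (Y ** M))"
    using X(4) Y(1) by (metis matrix_mul_assoc)
  also have "\<dots> = (Y ** M) ** (X ** M)"
    using X(4) Y(4) by (simp add: matrix_transpose_mul)
  also have "\<dots> = Y ** M"
    using X(1) by (metis matrix_mul_assoc)
  finally have XM: "X ** M = Y ** M" .
  show ?thesis
    using X(2) Y(2) MX XM by (metis matrix_mul_assoc)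
qed

lemma normal_equation_solvable:
  fixes M :: "real^'n^'m"
  shows "\<exists>X :: real^'m^'n. transpose M ** M ** X = transpose M"
proof -
  have "\<exists>x. transpose M *v (M *v x) = transpose M *v y" for y
  proof -
    have sub: "subspace (range ((*v) M))"
      using linear_subspace_image[OF matrix_vector_mul_linear subspace_UNIV] .
    obtain u z where u: "u \<in> span (range ((*v) M))"
      and z: "\<And>w. w \<in> span (range ((*v) M)) \<Longrightarrow> orthogonal z w" and y: "y = u + z"
      using orthogonal_subspace_decomp_exists[of "range ((*v) M)" y] by metis
    obtain x where x: "u = M *v x"
      using u sub by (metis imageE span_eq_iff)
    have "(transpose M *v z) \<bullet> w = 0" for w
      using z[of "M *v w"] by (simp add: orthogonal_def dot_lmul_matrix span_base)
    then have "transpose M *v z = 0"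
      using inner_eq_zero_iff by blast
    then show ?thesis
      by (auto simp: x y matrix_vector_right_distrib)
  qed
  then obtain f where f: "\<And>y. transpose M *v (M *v f y) = transpose M *v y" by metis
  have "transpose M ** M ** (\<chi> i j. f (axis j 1) $ i) = transpose M"
  proof -
    have "column j (transpose M ** M ** (\<chi> i j. f (axis j 1) $ i)) = column j (transpose M)" for j
    proof -
      have "column j (transpose M ** M ** (\<chi> i j. f (axis j 1) $ i))
          = transpose M ** M *v column j (\<chi> i j. f (axis j 1) $ i)"
        by (simp add: vec_eq_iff column_def matrix_matrix_mult_def matrix_vector_mult_def)
      also have "column j (\<chi> i j. f (axis j 1) $ i) = f (axis j 1)"
        by (simp add: column_def)
      finally show ?thesis
        using f[of "axis j 1"]
        by (simp add: matrix_vector_mul_assoc [symmetric] matrix_vector_mult_basis)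
    qed
    then show ?thesis by (simp add: vec_eq_iff column_def)
  qed
  then show ?thesis by blast
qed

lemma least_squares_inverse_exists:
  fixes N :: "real^'n^'m"
  shows "\<exists>X. N ** X ** N = N \<and> transpose (N ** X) = N ** X"
proof -
  obtain X where X: "transpose N ** N ** X = transpose N"
    using normal_equation_solvable by blast
  have "transpose (N ** X) ** (N ** X) = transpose (N ** X)"
    using X by (metis matrix_mul_assoc matrix_transpose_mul)
  then have sym: "transpose (N ** X) = N ** X"
    by (metis matrix_transpose_mul transpose_transpose)
  have "N ** X ** N = N"
    using X sym by (metis matrix_mul_assoc matrix_transpose_mul transpose_transpose)
  with sym show ?thesis by blast
qed

lemma is_mp_inverse_exists: "\<exists>X. is_mp_inverse M X"
proof -
  obtain X where X: "M ** X ** M = M" "transpose (M ** X) = M ** X"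
    using least_squares_inverse_exists by blast
  obtain Z where Z: "transpose M ** Z ** transpose M = transpose M"
      "transpose (transpose M ** Z) = transpose M ** Z"
    using least_squares_inverse_exists by blast
  define Y where "Y = transpose Z"
  have Y: "M ** Y ** M = M" "transpose (Y ** M) = Y ** M"
    using Z unfolding Y_def
    by (metis matrix_mul_assoc matrix_transpose_mul transpose_transpose)+
  have MX: "M ** (Y ** M ** X) = M ** X"
    using Y(1) by (simp add: matrix_mul_assoc)
  have XM: "Y ** M ** X ** M = Y ** M"
    using X(1) by (simp add: matrix_mul_assoc [symmetric])
  have "Y ** M ** X ** M ** (Y ** M ** X) = Y ** (M ** Y ** M) ** X"
    by (simp add: XM matrix_mul_assoc)
  then have "Y ** M ** X ** M ** (Y ** M ** X) = Y ** M ** X"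
    by (simp only: Y(1))
  then have "is_mp_inverse M (Y ** M ** X)"
    unfolding is_mp_inverse_def by (simp only: MX XM X Y simp_thms)
  then show ?thesis by blast
qed

definition mp_inverse :: "real^'n^'m \<Rightarrow> real^'m^'n" where
  "mp_inverse M = (THE X. is_mp_inverse M X)"

lemma is_mp_inverse_mp_inverse: "is_mp_inverse M (mp_inverse M)"
  unfolding mp_inverse_def
  using is_mp_inverse_exists is_mp_inverse_unique by (metis theI)

definition squat_mp_inverse :: "squat^'n^'m \<Rightarrow> squat^'m^'n" where
  "squat_mp_inverse A = inv real_rep (mp_inverse (real_rep A))"


section \<open>The Frobenius norm\<close>

text \<open>The library's \<^const>\<open>norm\<close> on \<open>real^'n^'m\<close> is the Euclidean norm of the Euclidean
  norms of the rows, i.e. the real Frobenius norm.\<close>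

definition frob_norm :: "squat^'n^'m \<Rightarrow> real" where
  "frob_norm A = sqrt ((norm (part1 A))\<^sup>2 + (norm (part2 A))\<^sup>2
                     + (norm (part3 A))\<^sup>2 + (norm (part4 A))\<^sup>2)"

end

theory Submission
  imports Defs
begin

text \<open>The real representation is an injective algebra homomorphism and scales the squared
  Frobenius norm by 2, so everything reduces to real matrices. There the residual
  \<open>A - P A Q\<close>, with \<open>P = C C\<^sup>\<dagger>\<close> and \<open>Q = R\<^sup>\<dagger> R\<close> the orthogonal projections, is annihilated by
  \<open>C\<^sup>T\<close> on the left and \<open>R\<^sup>T\<close> on the right, and hence is orthogonal to all matrices \<open>C W R\<close>;
  the norm identity is Pythagoras' theorem.\<close>

lemma sum_UNIV_sum_type:
  "(\<Sum>x\<in>(UNIV :: ('a::finite + 'b::finite) set). f x) = (\<Sum>a\<in>UNIV. f (Inl a)) + (\<Sum>b\<in>UNIV. f (Inr b))"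
  unfolding UNIV_Plus_UNIV [symmetric] by (subst sum.Plus) simp_all

lemma squat_sel_sum:
  "sq1 (sum f S) = (\<Sum>x\<in>S. sq1 (f x))" "sq2 (sum f S) = (\<Sum>x\<in>S. sq2 (f x))"
  "sq3 (sum f S) = (\<Sum>x\<in>S. sq3 (f x))" "sq4 (sum f S) = (\<Sum>x\<in>S. sq4 (f x))"
  by (induction S rule: infinite_finite_induct) auto

lemmas part_defs = part1_def part2_def part3_def part4_def

lemma real_rep_nth:
  "real_rep A $ Inl i $ Inl j = sq1 (A $ i $ j) + sq3 (A $ i $ j)"
  "real_rep A $ Inl i $ Inr j = sq4 (A $ i $ j) - sq2 (A $ i $ j)"
  "real_rep A $ Inr i $ Inl j = sq2 (A $ i $ j) + sq4 (A $ i $ j)"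
  "real_rep A $ Inr i $ Inr j = sq1 (A $ i $ j) - sq3 (A $ i $ j)"
  by (simp_all add: real_rep_def block_matrix_def part_defs)

text \<open>Sending \<open>q\<close> to the real 2 by 2 matrix with rows
  \<open>q1 + q3, q4 - q2\<close> and \<open>q2 + q4, q1 - q3\<close> respects the multiplication
  table. For matrices, the inner sum over the disjoint sum of indices splits into its two halves,
  which is the block product.\<close>

lemma real_rep_mult: "real_rep (A ** B) = real_rep A ** real_rep B"
proof -
  have "real_rep (A ** B) $ x $ y = (real_rep A ** real_rep B) $ x $ y" for x y
    by (cases x; cases y; simp add: real_rep_nth matrix_matrix_mult_def squat_sel_sum
        sum_UNIV_sum_type sum.distrib sum_subtractf algebra_simps)
  then show ?thesis by (simp add: vec_eq_iff)
qed

lemma real_rep_diff: "real_rep (A - B) = real_rep A - real_rep B"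
  by (simp add: vec_eq_iff split_sum_all real_rep_nth)

lemma real_rep_eq_iff: "real_rep A = real_rep B \<longleftrightarrow> A = B"
  using bij_real_rep by (auto dest: bij_is_inj injD)

text \<open>Surjectivity of \<open>real_rep\<close> makes \<open>inv real_rep\<close> a right
  inverse, so pseudoinverses pass through the representation.\<close>

lemma real_rep_mp_inverse: "real_rep (squat_mp_inverse A) = mp_inverse (real_rep A)"
  by (simp add: squat_mp_inverse_def bij_is_surj bij_real_rep surj_f_inv_f)

lemma norm_matrix_square:
  "(norm (M :: real^'n^'m))\<^sup>2 = (\<Sum>i\<in>UNIV. \<Sum>j\<in>UNIV. (M $ i $ j)\<^sup>2)"
  unfolding power2_norm_eq_inner by (simp add: inner_vec_def power2_eq_square)

text \<open>The cross terms cancel in \<open>(q1 + q3)^2 + (q1 - q3)^2 = 2 (q1^2 + q3^2)\<close>,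
  and likewise for \<open>q2\<close> and \<open>q4\<close>; hence the factor 2.\<close>

lemma frob_norm_square: "(frob_norm A)\<^sup>2 = (norm (real_rep A))\<^sup>2 / 2"
proof -
  have "(frob_norm A)\<^sup>2 = (norm (part1 A))\<^sup>2 + (norm (part2 A))\<^sup>2
                     + (norm (part3 A))\<^sup>2 + (norm (part4 A))\<^sup>2"
    by (simp add: frob_norm_def)
  also have "\<dots> = (norm (real_rep A))\<^sup>2 / 2"
    unfolding norm_matrix_square
    by (simp add: sum_UNIV_sum_type real_rep_nth part_defs sum.distrib sum_subtractf
        power2_eq_square algebra_simps)
  finally show ?thesis .
qed

lemma frob_norm_nonneg: "0 \<le> frob_norm A"
  by (simp add: frob_norm_def)

lemma frob_norm_eq_0_iff: "frob_norm A = 0 \<longleftrightarrow> A = 0"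
proof -
  have "frob_norm A = 0 \<longleftrightarrow> real_rep A = 0"
    using frob_norm_square[of A] by auto
  also have "\<dots> \<longleftrightarrow> A = 0"
    \<comment> \<open>The instance \<open>real_rep_diff[of 0 0]\<close> yields
      \<open>real_rep 0 = 0\<close>.\<close>
    using real_rep_eq_iff[of A 0] real_rep_diff[of 0 0] by auto
  finally show ?thesis .
qed

text \<open>This is the adjoint of left multiplication for the Frobenius inner product. Both sides
  are the same triple sum; three interchanges carry \<open>i\<close> from the outermost to the
  innermost position.\<close>

lemma inner_matrix_mult_left:
  fixes M :: "real^'k^'m" and N :: "real^'n^'k"
  shows "(M ** N) \<bullet> D = N \<bullet> (transpose M ** D)"
proof -
  have "(M ** N) \<bullet> D = (\<Sum>i\<in>UNIV. \<Sum>j\<in>UNIV. \<Sum>l\<in>UNIV. M $ i $ l * N $ l $ j * D $ i $ j)"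
    by (simp add: inner_vec_def matrix_matrix_mult_def sum_distrib_right)
  also have "\<dots> = (\<Sum>i\<in>UNIV. \<Sum>l\<in>UNIV. \<Sum>j\<in>UNIV. M $ i $ l * N $ l $ j * D $ i $ j)"
    by (intro sum.cong refl sum.swap)
  also have "\<dots> = (\<Sum>l\<in>UNIV. \<Sum>i\<in>UNIV. \<Sum>j\<in>UNIV. M $ i $ l * N $ l $ j * D $ i $ j)"
    by (rule sum.swap)
  also have "\<dots> = (\<Sum>l\<in>UNIV. \<Sum>j\<in>UNIV. \<Sum>i\<in>UNIV. M $ i $ l * N $ l $ j * D $ i $ j)"
    by (intro sum.cong refl sum.swap)
  also have "\<dots> = N \<bullet> (transpose M ** D)"
    by (simp add: inner_vec_def matrix_matrix_mult_def transpose_def sum_distrib_left mult_ac)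
  finally show ?thesis .
qed

lemma inner_transpose: "transpose M \<bullet> transpose N = (M :: real^'n^'m) \<bullet> N"
  unfolding inner_vec_def transpose_def by (simp, rule sum.swap)

text \<open>Transposition preserves the inner product and exchanges left and right factors, which
  reduces the claim to left multiplication.\<close>

lemma inner_matrix_mult_right:
  fixes M :: "real^'k^'m" and N :: "real^'n^'k"
  shows "(M ** N) \<bullet> D = M \<bullet> (D ** transpose N)"
proof -
  have "(M ** N) \<bullet> D = (transpose N ** transpose M) \<bullet> transpose D"
    by (simp only: inner_transpose matrix_transpose_mul [symmetric])
  also have "\<dots> = transpose M \<bullet> (N ** transpose D)"
    by (simp only: inner_matrix_mult_left transpose_transpose)
  also have "\<dots> = transpose M \<bullet> transpose (D ** transpose N)"
    by (simp only: matrix_transpose_mul transpose_transpose)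
  finally show ?thesis by (simp only: inner_transpose)
qed

lemma matrix_diff_ldistrib: "M ** (N - K) = M ** N - M ** (K :: 'a::ring_1^'n^'k)"
  by (simp add: vec_eq_iff matrix_matrix_mult_def algebra_simps sum_subtractf)

lemma matrix_diff_rdistrib: "(N - K) ** M = N ** M - K ** (M :: 'a::ring_1^'n^'k)"
  by (simp add: vec_eq_iff matrix_matrix_mult_def algebra_simps sum_subtractf)

lemma least_squares_pythagoras:
  fixes A :: "real^'n^'m" and C :: "real^'k^'m" and R :: "real^'n^'l" and U :: "real^'l^'k"
  defines "B \<equiv> C ** mp_inverse C ** A ** (mp_inverse R ** R)"
  shows "(norm (A - C ** U ** R))\<^sup>2 = (norm (A - B))\<^sup>2 + (norm (B - C ** U ** R))\<^sup>2"
proof -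
  \<comment> \<open>This \<open>W\<close> puts the second summand in the form
    \<open>C ** W ** R\<close>.\<close>
  define W where "W = mp_inverse C ** A ** mp_inverse R - U"
  have W: "B - C ** U ** R = C ** W ** R"
    by (simp add: B_def W_def matrix_diff_ldistrib matrix_diff_rdistrib matrix_mul_assoc)
  have C: "transpose C ** (C ** mp_inverse C) = transpose C"
  proof -
    \<comment> \<open>The transpose is split at the outer product only, so that
      \<open>C ** mp_inverse C\<close> stays whole and its symmetry applies.\<close>
    have "transpose (C ** mp_inverse C ** C) = transpose C ** (C ** mp_inverse C)"
      unfolding matrix_transpose_mul [of "C ** mp_inverse C"]
      using is_mp_inverse_mp_inverse[of C] by (simp add: is_mp_inverse_def)
    then show ?thesis
      using is_mp_inverse_mp_inverse[of C] by (simp add: is_mp_inverse_def)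
  qed
  have R: "(mp_inverse R ** R) ** transpose R = transpose R"
  proof -
    have "transpose (R ** (mp_inverse R ** R)) = (mp_inverse R ** R) ** transpose R"
      unfolding matrix_transpose_mul [of R]
      using is_mp_inverse_mp_inverse[of R] by (simp add: is_mp_inverse_def)
    then show ?thesis
      using is_mp_inverse_mp_inverse[of R] by (simp only: is_mp_inverse_def matrix_mul_assoc)
  qed
  \<comment> \<open>The outer factors absorb both projections, so \<open>B\<close> and
    \<open>A\<close> have the same image under this two-sided multiplication.\<close>
  have "transpose C ** B ** transpose R
      = (transpose C ** (C ** mp_inverse C)) ** A ** ((mp_inverse R ** R) ** transpose R)"
    by (simp add: B_def matrix_mul_assoc)
  then have "transpose C ** (A - B) ** transpose R = 0"
    by (simp add: C R matrix_diff_ldistrib matrix_diff_rdistrib)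
  moreover have "(C ** W ** R) \<bullet> (A - B) = W \<bullet> (transpose C ** (A - B) ** transpose R)"
    by (simp only: inner_matrix_mult_right [of "C ** W"] inner_matrix_mult_left [of C W]
        matrix_mul_assoc)
  ultimately have "orthogonal (A - B) (B - C ** U ** R)"
    by (simp add: W orthogonal_def inner_commute)
  from norm_add_Pythagorean[OF this] show ?thesis by simp
qed

text \<open>Full column rank gives \<open>C\<close> a left inverse and full row rank gives
  \<open>R\<close> a right inverse; multiplying by them isolates the middle factor.\<close>

lemma full_rank_sandwich_cancel:
  fixes C :: "real^'k^'m" and R :: "real^'n^'l" and U V :: "real^'l^'k"
  assumes "rank C = CARD('k)" "rank R = CARD('l)" "C ** U ** R = C ** V ** R"
  shows "U = V"
proof -
  obtain L where L: "L ** C = mat 1"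
    using assms(1) full_rank_injective[of C] matrix_left_invertible_injective[of C] by blast
  obtain S where S: "R ** S = mat 1"
    using assms(2) full_rank_surjective[of R] matrix_right_invertible_surjective[of R] by blast
  have "L ** (C ** W ** R) ** S = W" for W :: "real^'l^'k"
  proof -
    have "L ** (C ** W ** R) ** S = (L ** C) ** W ** (R ** S)"
      by (simp only: matrix_mul_assoc)
    then show ?thesis by (simp add: L S)
  qed
  then show ?thesis using assms(3) by metis
qed

text \<open>All three terms of the real identity carry the same factor 1/2 under the
  representation.\<close>

lemma frob_norm_pythagoras:
  fixes A :: "squat^'n^'m" and C :: "squat^'k^'m" and R :: "squat^'n^'l" and U :: "squat^'l^'k"
  defines "B \<equiv> C ** squat_mp_inverse C ** A ** (squat_mp_inverse R ** R)"
  shows "(frob_norm (A - C ** U ** R))\<^sup>2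
    = (frob_norm (A - B))\<^sup>2 + (frob_norm (B - C ** U ** R))\<^sup>2"
  using least_squares_pythagoras[of "real_rep A" "real_rep C" "real_rep U" "real_rep R"]
  by (simp add: B_def frob_norm_square real_rep_diff real_rep_mult real_rep_mp_inverse)

theorem theorem5p1:
  fixes A :: "squat^'n^'m" and C :: "squat^'k^'m" and R :: "squat^'n^'k"
    and Ustar :: "squat^'k^'k" and PC :: "squat^'m^'m" and PR :: "squat^'n^'n"
  assumes Ustar: "Ustar = squat_mp_inverse C ** A ** squat_mp_inverse R"
    and PC: "PC = C ** squat_mp_inverse C"
    and PR: "PR = squat_mp_inverse R ** R"
  shows
    "is_arg_min (\<lambda>U. frob_norm (A - C ** U ** R)) (\<lambda>_. True) Ustar
   \<and> C ** Ustar ** R = PC ** A ** PR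
   \<and> (\<forall>U :: squat^'k^'k.
        (frob_norm (A - C ** U ** R))\<^sup>2
          = (frob_norm (A - PC ** A ** PR))\<^sup>2 + (frob_norm (PC ** A ** PR - C ** U ** R))\<^sup>2)
   \<and> ((\<exists>U :: squat^'k^'k. frob_norm (A - C ** U ** R) = frob_norm (A - PC ** A ** PR))
      \<and> (\<forall>U :: squat^'k^'k. frob_norm (A - PC ** A ** PR) \<le> frob_norm (A - C ** U ** R)))
   \<and> (\<exists>(A' :: squat^'n^'m) (C' :: squat^'k^'m) (R' :: squat^'n^'k) U V.
        is_arg_min (\<lambda>U. frob_norm (A' - C' ** U ** R')) (\<lambda>_. True) U
        \<and> is_arg_min (\<lambda>U. frob_norm (A' - C' ** U ** R')) (\<lambda>_. True) V
        \<and> U \<noteq> V)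
   \<and> (rank (real_rep C) = CARD('k + 'k) \<and> rank (real_rep R) = CARD('k + 'k) \<longrightarrow>
        (\<exists>!U. is_arg_min (\<lambda>U. frob_norm (A - C ** U ** R)) (\<lambda>_. True) U))"
proof -
  let ?f = "\<lambda>U. frob_norm (A - C ** U ** R)"
  define B where "B = PC ** A ** PR"
  have star: "C ** Ustar ** R = B"
    by (simp add: B_def Ustar PC PR matrix_mul_assoc)
  have pyth: "(?f U)\<^sup>2 = (frob_norm (A - B))\<^sup>2 + (frob_norm (B - C ** U ** R))\<^sup>2" for U
    unfolding B_def PC PR by (rule frob_norm_pythagoras)
  have le: "frob_norm (A - B) \<le> ?f U" for U
    by (rule power2_le_imp_le) (simp_all add: pyth frob_norm_nonneg)
  have min_iff: "is_arg_min ?f (\<lambda>_. True) U \<longleftrightarrow> C ** U ** R = B" for U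
  proof -
    \<comment> \<open>\<open>Ustar\<close> attains the lower bound \<open>le\<close>, so minimizing
      means attaining that bound.\<close>
    have "is_arg_min ?f (\<lambda>_. True) U \<longleftrightarrow> ?f U = frob_norm (A - B)"
      using le star unfolding is_arg_min_def by (metis order_antisym_conv not_less)
    also have "\<dots> \<longleftrightarrow> (?f U)\<^sup>2 = (frob_norm (A - B))\<^sup>2"
      by (simp add: frob_norm_nonneg)
    also have "\<dots> \<longleftrightarrow> C ** U ** R = B"
      by (auto simp: pyth frob_norm_eq_0_iff)
    finally show ?thesis .
  qed
  have nonunique: "\<exists>(A' :: squat^'n^'m) (C' :: squat^'k^'m) (R' :: squat^'n^'k) U V.
        is_arg_min (\<lambda>U. frob_norm (A' - C' ** U ** R')) (\<lambda>_. True) U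
        \<and> is_arg_min (\<lambda>U. frob_norm (A' - C' ** U ** R')) (\<lambda>_. True) V
        \<and> U \<noteq> V"
  proof (intro exI conjI)
    \<comment> \<open>With all data zero the objective is constant, so every \<open>V\<close> is a
      minimizer; the distinct witnesses are \<open>mat 1\<close> and \<open>0\<close>.\<close>
    show "is_arg_min (\<lambda>U. frob_norm ((0 :: squat^'n^'m) - (0 :: squat^'k^'m) ** U ** (0 :: squat^'n^'k)))
        (\<lambda>_. True) V" for V
      by (simp add: is_arg_min_def)
    then show "is_arg_min (\<lambda>U. frob_norm ((0 :: squat^'n^'m) - (0 :: squat^'k^'m) ** U ** (0 :: squat^'n^'k)))
        (\<lambda>_. True) 0" .
    show "(mat 1 :: squat^'k^'k) \<noteq> 0"
      by (auto simp: vec_eq_iff mat_def)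
  qed
  have unique: "\<exists>!U. is_arg_min ?f (\<lambda>_. True) U"
    if "rank (real_rep C) = CARD('k + 'k)" "rank (real_rep R) = CARD('k + 'k)"
  proof (rule ex1I)
    show "is_arg_min ?f (\<lambda>_. True) Ustar"
      by (simp add: min_iff star)
  next
    fix U
    assume "is_arg_min ?f (\<lambda>_. True) U"
    \<comment> \<open>The rank hypotheses concern the representations, so cancellation happens there
      and injectivity brings the result back.\<close>
    then have "real_rep (C ** U ** R) = real_rep (C ** Ustar ** R)"
      by (simp add: min_iff star)
    then have "real_rep U = real_rep Ustar"
      using full_rank_sandwich_cancel[OF that] by (simp add: real_rep_mult)
    then show "U = Ustar" by (simp add: real_rep_eq_iff)
  qed
  have attained: "\<exists>U. ?f U = frob_norm (A - B)"
    using star by blast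
  show ?thesis
    unfolding B_def [symmetric]
    using star pyth le min_iff nonunique unique attained by blast
qed

end
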